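(* Let $d$ and $k_0$ be positive integers, let $\Gamma$ be a group acting by isometries on a complete $\mathrm{CAT}(0)$ space $X$ of dimension at most $d$, and let $\Lambda<\Gamma$ be a subgroup with a finite generating set $\mathcal{A}$ that has ample duplication for dimension $d$, with base $k_0$. If $\langle S\rangle$ has a fixed point in $X$ for every $S\subseteq\mathcal{A}$ with $|S|\le k_0$, then $\Lambda$ has a fixed point in $X$.
   Context: Given a group $\Gamma$ and positive integers $d$ and $k_0$, a finite generating set $\mathcal{A}$ for a subgroup $\Lambda<\Gamma$ has ample duplication for dimension $d$, with base $k_0$, if there is a function $f:\mathbb{N}\to\mathbb{N}$ such that: (1) each subset $S\subseteq\mathcal{A}$ of cardinality $|S|>k_0$ either can be written as a disjoint union $S=S_1\sqcup S_2$ where the $S_i$ are non-empty and $\langle S_1\rangle$ normalizes $\langle S_2\rangle$, or else there are at least $f(|S|)$ (pairwise) commuting conjugates of $\langle S\rangle$ in $\Gamma$; and (2) $d<(k-1)f(k)$ for $k=k_0+1,\dots,\min\{d+1,|\mathcal{A}|\}$. All conjugates are taken in the ambient group $\Gamma$. Subgroups $H_1,H_2$ commute if $[h_1,h_2]=1$ for all $h_i\in H_i$. $\mathrm{CAT}(0)$ spaces are non-empty and not assumed locally compact; an action by isometries is a homomorphism $\Gamma\to\mathrm{Isom}(X)$. Dimension means topological covering dimension: $\dim(X)\le d$ if for every closed subspace $K\subseteq X$ and every $r\ge d$, every continuous map $K\to\mathbb{S}^r$ to the $r$-sphere extends to a continuous map $X\to\mathbb{S}^r$. *)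

theory Defs
  imports "HOL-Analysis.Analysis" "HOL-Algebra.Group_Action" "HOL-Algebra.Generated_Groups"
begin

text \<open>
  Metric spaces are subsets \<open>X\<close> of a metric-space type, with the restricted metric and the
  subspace topology \<open>top_of_set X\<close>.
\<close>

section \<open>CAT(0) spaces\<close>

definition geodesic_segment :: "'x::metric_space set \<Rightarrow> 'x set \<Rightarrow> 'x \<Rightarrow> 'x \<Rightarrow> bool" where
  "geodesic_segment X s x y \<longleftrightarrow>
     (\<exists>c. s = c ` {0..dist x y} \<and> s \<subseteq> X \<and> c 0 = x \<and> c (dist x y) = y \<and>
          (\<forall>t\<in>{0..dist x y}. \<forall>t'\<in>{0..dist x y}. dist (c t) (c t') = \<bar>t - t'\<bar>))"

definition geodesic_space :: "'x::metric_space set \<Rightarrow> bool" where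
  "geodesic_space X \<longleftrightarrow> (\<forall>x\<in>X. \<forall>y\<in>X. \<exists>s. geodesic_segment X s x y)"

text \<open>\<open>u'\<close> is the point of the Euclidean segment \<open>[x', y']\<close> that corresponds to the point
  \<open>u\<close> of the geodesic segment \<open>s\<close> issuing from \<open>x\<close>.\<close>

definition side_comparison_point ::
    "'x::metric_space set \<Rightarrow> 'x \<Rightarrow> real^2 \<Rightarrow> real^2 \<Rightarrow> 'x \<Rightarrow> real^2 \<Rightarrow> bool" where
  "side_comparison_point s x x' y' u u' \<longleftrightarrow>
     u \<in> s \<and> u' \<in> closed_segment x' y' \<and> dist x' u' = dist x u"

definition cat0_space :: "'x::metric_space set \<Rightarrow> bool" where
  "cat0_space X \<longleftrightarrow>
     X \<noteq> {} \<and> geodesic_space X \<and>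
     (\<forall>x\<in>X. \<forall>y\<in>X. \<forall>z\<in>X. \<forall>sxy syz szx. \<forall>x' y' z' :: real^2.
        geodesic_segment X sxy x y \<and> geodesic_segment X syz y z \<and> geodesic_segment X szx z x \<and>
        dist x' y' = dist x y \<and> dist y' z' = dist y z \<and> dist z' x' = dist z x \<longrightarrow>
        (let comparison = (\<lambda>u u'. side_comparison_point sxy x x' y' u u' \<or>
                                   side_comparison_point syz y y' z' u u' \<or>
                                   side_comparison_point szx z z' x' u u')
         in \<forall>u v u' v'. comparison u u' \<and> comparison v v' \<longrightarrow> dist u v \<le> dist u' v'))"


section \<open>Covering dimension\<close>

text \<open>\<open>nsphere r\<close> is the unit sphere of dimension \<open>r\<close>, in \<open>\<real>\<^sup>r\<^sup>+\<^sup>1\<close>.\<close>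

definition covering_dim_le :: "'x topology \<Rightarrow> nat \<Rightarrow> bool" where
  "covering_dim_le T d \<longleftrightarrow>
     (\<forall>K r f. closedin T K \<and> d \<le> r \<and> continuous_map (subtopology T K) (nsphere r) f \<longrightarrow>
        (\<exists>g. continuous_map T (nsphere r) g \<and> (\<forall>x\<in>K. g x = f x)))"


section \<open>Isometric actions and fixed points\<close>

definition isometric_action ::
    "('g, 'b) monoid_scheme \<Rightarrow> 'x::metric_space set \<Rightarrow> ('g \<Rightarrow> 'x \<Rightarrow> 'x) \<Rightarrow> bool" where
  "isometric_action G X \<phi> \<longleftrightarrow>
     group_action G X \<phi> \<and>
     (\<forall>g\<in>carrier G. \<forall>x\<in>X. \<forall>y\<in>X. dist (\<phi> g x) (\<phi> g y) = dist x y)"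

definition has_fixed_point :: "('g \<Rightarrow> 'x \<Rightarrow> 'x) \<Rightarrow> 'x set \<Rightarrow> 'g set \<Rightarrow> bool" where
  "has_fixed_point \<phi> X H \<longleftrightarrow> (\<exists>x\<in>X. \<forall>h\<in>H. \<phi> h x = x)"


section \<open>Ample duplication\<close>

definition commuting_subgroups :: "('g, 'b) monoid_scheme \<Rightarrow> 'g set \<Rightarrow> 'g set \<Rightarrow> bool" where
  "commuting_subgroups G H1 H2 \<longleftrightarrow>
     (\<forall>h1\<in>H1. \<forall>h2\<in>H2. h1 \<otimes>\<^bsub>G\<^esub> h2 \<otimes>\<^bsub>G\<^esub> inv\<^bsub>G\<^esub> h1 \<otimes>\<^bsub>G\<^esub> inv\<^bsub>G\<^esub> h2 = \<one>\<^bsub>G\<^esub>)"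

definition conjugates :: "('g, 'b) monoid_scheme \<Rightarrow> 'g set \<Rightarrow> 'g set set" where
  "conjugates G H = (\<lambda>g. g <#\<^bsub>G\<^esub> H #>\<^bsub>G\<^esub> inv\<^bsub>G\<^esub> g) ` carrier G"

text \<open>
  Conjugates are counted as distinct subgroups. Counting them with repetition would give the
  same notion when \<open>k0 > 0\<close>: a repeated conjugate would commute with itself, so \<open>\<langle>S\<rangle>\<close> would be
  abelian, and then any splitting of \<open>S\<close> into two non-empty parts satisfies the first alternative.
\<close>

definition ample_duplication ::
    "('g, 'b) monoid_scheme \<Rightarrow> 'g set \<Rightarrow> nat \<Rightarrow> nat \<Rightarrow> bool" where
  "ample_duplication G A d k0 \<longleftrightarrow>
     (\<exists>f :: nat \<Rightarrow> nat.
        (\<forall>S. S \<subseteq> A \<and> card S > k0 \<longrightarrow>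
           (\<exists>S1 S2. S = S1 \<union> S2 \<and> S1 \<inter> S2 = {} \<and> S1 \<noteq> {} \<and> S2 \<noteq> {} \<and>
                    generate G S1 \<subseteq> normalizer G (generate G S2)) \<or>
           (\<exists>C. C \<subseteq> conjugates G (generate G S) \<and> finite C \<and> card C \<ge> f (card S) \<and>
                pairwise (commuting_subgroups G) C)) \<and>
        (\<forall>k \<in> {k0 + 1..min (d + 1) (card A)}. d < (k - 1) * f k))"

end

theory Submission
  imports Defs "HOL-Homology.Brouwer_Degree"
begin

text \<open>
  By induction on \<open>S \<subseteq> A\<close>, every subgroup \<open>\<langle>S\<rangle>\<close> has a fixed point; up to \<open>k0\<close> elements this is
  the hypothesis. For larger sets there are two cases. If \<open>S = S1 \<union> S2\<close> and
  \<open>\<langle>S1\<rangle>\<close> normalises \<open>\<langle>S2\<rangle>\<close>, then \<open>\<langle>S1\<rangle>\<close> preserves the closed convex set \<open>Fix S2\<close>, and the point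
  of \<open>Fix S2\<close> nearest to a fixed point of \<open>\<langle>S1\<rangle>\<close> is fixed by everything
  (\<open>fixed_points_normalised\<close>). Otherwise there are \<open>n\<close> commuting conjugates of \<open>\<langle>S\<rangle>\<close> with
  \<open>d < n * (card S - 1)\<close>; when \<open>card S > d + 1\<close> the subgroup itself, with \<open>n = 1\<close>, is
  enough. Choose one generator in each conjugate and drop it. What is left of each conjugate has a
  fixed point by induction, and commuting families with fixed points have a common one, by
  nearest points again (\<open>fixed_points_commuting\<close>). So the fixed-point sets of the generators,
  arranged in one block per conjugate, meet as soon as one set is omitted from every block.

  The topological core is \<open>block_helly\<close>: in dimension at most \<open>d\<close> this forces some block to have
  a common point. Suppose not, put \<open>m + 1 = card S\<close>, and let \<open>K\<close> be the union of all the sets.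
  The closed convex sets then have the intersection pattern of the facets of a product of \<open>n\<close>
  simplices of dimension \<open>m\<close>, whose boundary is a sphere of dimension \<open>r = n * m - 1 \<ge> d\<close>.
  Differences of distances to the sets of one block give a map from \<open>K\<close> to that sphere,
  which extends to a map \<open>h\<close> on \<open>X\<close> by the dimension hypothesis. In the other direction, the
  vertices of the product are sent to points in the assumed intersections, and barycentres extend
  this to the whole product, so that facets go into the corresponding sets. The composite of the
  boundary sphere into \<open>X\<close> with \<open>h\<close> is null-homotopic because it extends over the product. It
  also never sends \<open>v\<close> to \<open>-v\<close>, hence is homotopic to the identity. As spheres are not
  contractible, this is a contradiction.

  The barycentre is the minimiser of the weighted sum of squared distances. Existence,
  continuity in the weights, and membership in every closed convex set that contains the points of
  positive weight all come from the strong convexity of squared distances in a CAT(0) space.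
\<close>

section \<open>Comparison inequality and convexity in CAT(0) spaces\<close>

lemma euclidean_stewart:
  fixes x y p :: "'a::real_inner"
  shows "(dist p ((1 - t) *\<^sub>R x + t *\<^sub>R y))\<^sup>2
           = (1 - t) * (dist p x)\<^sup>2 + t * (dist p y)\<^sup>2 - t * (1 - t) * (dist x y)\<^sup>2"
proof -
  define a b where "a = x - p" and "b = y - p"
  have 1: "dist p ((1 - t) *\<^sub>R x + t *\<^sub>R y) = norm ((1 - t) *\<^sub>R a + t *\<^sub>R b)"
    by (simp add: dist_norm a_def b_def algebra_simps norm_minus_commute)
  have 2: "dist p x = norm a" "dist p y = norm b" "dist x y = norm (a - b)"
    by (simp_all add: dist_norm a_def b_def norm_minus_commute)
  show ?thesis
    unfolding 1 2 power2_norm_eq_inner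
    by (simp add: inner_simps inner_commute) (simp add: algebra_simps)
qed

text \<open>The first side lies on the horizontal axis; the law of cosines gives the abscissa of the third
  vertex, and the triangle inequalities say that its squared ordinate is non-negative.\<close>

lemma comparison_triangle:
  fixes a b c :: real
  assumes "0 \<le> a" "0 \<le> b" "0 \<le> c" "a \<le> b + c" "b \<le> a + c" "c \<le> a + b"
  obtains x y z :: "real^2" where "dist x y = a" "dist y z = b" "dist z x = c"
proof (cases "a = 0")
  case True
  then have "b = c" using assms by linarith
  have "dist (0::real^2) 0 = a" "dist 0 (vector [c, 0] :: real^2) = b" "dist (vector [c, 0]) (0 :: real^2) = c"
    using True \<open>b = c\<close> assms by (simp_all add: dist_vec_def L2_set_def UNIV_2)
  then show ?thesis using that by blast
next
  case False
  with assms have "a > 0" by simp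
  define p where "p = (a\<^sup>2 + c\<^sup>2 - b\<^sup>2) / (2 * a)"
  have ap: "2 * a * p = a\<^sup>2 + c\<^sup>2 - b\<^sup>2" using \<open>a > 0\<close> by (simp add: p_def)
  have "p \<le> c"
  proof -
    have "(a - c)\<^sup>2 \<le> b\<^sup>2" using assms by (simp add: abs_le_square_iff[symmetric] abs_le_iff)
    then have "2 * a * p \<le> 2 * a * c" unfolding ap by (simp add: power2_diff)
    then show ?thesis using \<open>a > 0\<close> by simp
  qed
  moreover have "- c \<le> p"
  proof -
    have "b\<^sup>2 \<le> (a + c)\<^sup>2" using assms by (intro power_mono) auto
    then have "2 * a * (- c) \<le> 2 * a * p" unfolding ap by (simp add: power2_sum)
    then show ?thesis using \<open>a > 0\<close> by (simp only: mult_le_cancel_left_pos mult_pos_pos zero_less_numeral)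
  qed
  ultimately have "p\<^sup>2 \<le> c\<^sup>2" using assms by (simp add: abs_le_square_iff[symmetric] abs_le_iff)
  define q where "q = sqrt (c\<^sup>2 - p\<^sup>2)"
  have q: "q\<^sup>2 = c\<^sup>2 - p\<^sup>2" using \<open>p\<^sup>2 \<le> c\<^sup>2\<close> by (simp add: q_def)
  have "(a - p)\<^sup>2 + q\<^sup>2 = b\<^sup>2" using ap by (simp add: q power2_diff)
  then have "dist (vector [a, 0] :: real^2) (vector [p, q]) = b"
    using assms by (simp add: dist_vec_def L2_set_def UNIV_2 dist_real_def)
  moreover have "dist (vector [p, q]) (0 :: real^2) = c"
    using assms by (simp add: dist_vec_def L2_set_def UNIV_2 q)
  moreover have "dist (0 :: real^2) (vector [a, 0]) = a"
    using assms by (simp add: dist_vec_def L2_set_def UNIV_2)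
  ultimately show ?thesis using that by blast
qed

text \<open>The inequality of Bruhat and Tits for the point at parameter \<open>t\<close> of a geodesic, stated
  without the geodesic: it determines the point and is all that is needed of the comparison
  condition.\<close>

definition cn_point :: "'x::metric_space set \<Rightarrow> 'x \<Rightarrow> 'x \<Rightarrow> real \<Rightarrow> 'x \<Rightarrow> bool" where
  "cn_point X x y t z \<longleftrightarrow> z \<in> X \<and>
     (\<forall>p\<in>X. (dist p z)\<^sup>2 \<le> (1 - t) * (dist p x)\<^sup>2 + t * (dist p y)\<^sup>2 - t * (1 - t) * (dist x y)\<^sup>2)"

text \<open>Comparing a vertex of a triangle with a point of the opposite side turns the Euclidean identity
  of Stewart into an inequality.\<close>

lemma cat0_cn_point:
  assumes "cat0_space X" "x \<in> X" "y \<in> X" "0 \<le> t" "t \<le> 1"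
  obtains z where "cn_point X x y t z"
proof -
  have geo: "geodesic_space X" using assms(1) by (simp add: cat0_space_def)
  then obtain sxy where sxy: "geodesic_segment X sxy x y" 
    using assms unfolding geodesic_space_def by blast
  then obtain c where c: "sxy = c ` {0..dist x y}" "sxy \<subseteq> X" "c 0 = x"
    "\<And>r s. r \<in> {0..dist x y} \<Longrightarrow> s \<in> {0..dist x y} \<Longrightarrow> dist (c r) (c s) = \<bar>r - s\<bar>"
    unfolding geodesic_segment_def by blast
  define z where "z = c (t * dist x y)"
  have tin: "t * dist x y \<in> {0..dist x y}" using assms by (simp add: mult_left_le_one_le)
  have zs: "z \<in> sxy" using tin c(1) by (simp add: z_def)
  have dxz: "dist x z = t * dist x y"
    using c(4)[OF _ tin, of 0] c(3) tin by (simp add: z_def)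
  have "(dist p z)\<^sup>2 \<le> (1 - t) * (dist p x)\<^sup>2 + t * (dist p y)\<^sup>2 - t * (1 - t) * (dist x y)\<^sup>2"
    if pX: "p \<in> X" for p
  proof -
    obtain syp spx where s: "geodesic_segment X syp y p" "geodesic_segment X spx p x"
      using geo assms(2,3) pX unfolding geodesic_space_def by blast
    obtain x' y' p' :: "real^2" where
      tri: "dist x' y' = dist x y" "dist y' p' = dist y p" "dist p' x' = dist p x"
    proof (rule comparison_triangle[of "dist x y" "dist y p" "dist p x"])
      show "dist x y \<le> dist y p + dist p x"
        using dist_triangle[of x y p] by (simp add: dist_commute)
      show "dist y p \<le> dist x y + dist p x"
        using dist_triangle[of y p x] by (simp add: dist_commute)
      show "dist p x \<le> dist x y + dist y p"
        using dist_triangle[of p x y] by (simp add: dist_commute)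
    qed auto
    define z' where "z' = (1 - t) *\<^sub>R x' + t *\<^sub>R y'"
    have "dist x' z' = t * dist x' y'"
    proof -
      have "x' - z' = t *\<^sub>R (x' - y')" by (simp add: z'_def algebra_simps)
      then show ?thesis using assms by (simp add: dist_norm)
    qed
    moreover have "z' \<in> closed_segment x' y'"
      using assms by (auto simp: closed_segment_def z'_def)
    ultimately have cz: "side_comparison_point sxy x x' y' z z'"
      using zs dxz tri by (simp add: side_comparison_point_def)
    have "p \<in> spx"
      using s(2) unfolding geodesic_segment_def by force
    then have cp: "side_comparison_point spx p p' x' p p'"
      by (simp add: side_comparison_point_def)
    have "dist p z \<le> dist p' z'"
      using assms(1)[unfolded cat0_space_def Let_def, THEN conjunct2, THEN conjunct2, rule_format,
        OF assms(2,3) pX, of sxy syp spx x' y' p' p p' z z'] sxy s tri cz cp by blast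
    then have "(dist p z)\<^sup>2 \<le> (dist p' z')\<^sup>2" by simp
    then show ?thesis
      unfolding z'_def euclidean_stewart using tri by (simp add: dist_commute[of _ p] dist_commute[of _ p'])
  qed
  then have "cn_point X x y t z" using zs c(2) by (auto simp: cn_point_def)
  then show ?thesis by (rule that)
qed

text \<open>Geodesics are unique here, so convexity can be expressed by metric betweenness.\<close>

definition convex_in :: "'x::metric_space set \<Rightarrow> 'x set \<Rightarrow> bool" where
  "convex_in X C \<longleftrightarrow> C \<subseteq> X \<and>
     (\<forall>x\<in>C. \<forall>y\<in>C. \<forall>z\<in>X. dist x z + dist z y = dist x y \<longrightarrow> z \<in> C)"

lemma convex_inD:
  "convex_in X C \<Longrightarrow> x \<in> C \<Longrightarrow> y \<in> C \<Longrightarrow> z \<in> X \<Longrightarrow> dist x z + dist z y = dist x y \<Longrightarrow> z \<in> C"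
  unfolding convex_in_def by blast

text \<open>Taking the two end points as test points bounds both distances from above, and the triangle
  inequality makes the bounds sharp.\<close>

lemma cn_point_dist:
  assumes "cn_point X x y t z" "x \<in> X" "y \<in> X" "0 \<le> t" "t \<le> 1"
  shows "dist x z = t * dist x y" "dist z y = (1 - t) * dist x y"
proof -
  have "(dist x z)\<^sup>2 \<le> (t * dist x y)\<^sup>2" "(dist y z)\<^sup>2 \<le> ((1 - t) * dist x y)\<^sup>2"
    using assms(1-3) unfolding cn_point_def
    by (force simp: dist_commute power2_eq_square algebra_simps)+
  then have "dist x z \<le> t * dist x y" "dist y z \<le> (1 - t) * dist x y"
    using assms(4,5) by (auto intro: power2_le_imp_le)
  moreover have "dist x y \<le> dist x z + dist y z" by (simp add: dist_triangle2 )
  ultimately show "dist x z = t * dist x y" "dist z y = (1 - t) * dist x y"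
    unfolding left_diff_distrib dist_commute[of z y] by linarith+
qed

text \<open>With \<open>z'\<close> itself as test point, the right-hand side of the inequality vanishes.\<close>

lemma cn_point_unique:
  assumes "cn_point X x y t z" "z' \<in> X" "dist x z' = t * dist x y" "dist z' y = (1 - t) * dist x y"
  shows "z' = z"
proof -
  have "(dist z' z)\<^sup>2 \<le> (1 - t) * (dist z' x)\<^sup>2 + t * (dist z' y)\<^sup>2 - t * (1 - t) * (dist x y)\<^sup>2"
    using assms(1,2) by (simp add: cn_point_def)
  also have "\<dots> = 0"
  proof -
    have d: "dist z' x = t * dist x y" using assms(3) by (simp add: dist_commute)
    show ?thesis unfolding d assms(4) by (simp add: power2_eq_square algebra_simps)
  qed
  finally show ?thesis by simp
qed

locale hadamard_space =
  fixes X :: "'x::metric_space set"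
  assumes complete_space: "complete X" and cat0: "cat0_space X"
begin

lemma between_unique:
  assumes "x \<in> X" "y \<in> X" "z \<in> X" "z' \<in> X"
    and "dist x z + dist z y = dist x y" "dist x z' + dist z' y = dist x y" "dist x z' = dist x z"
  shows "z' = z"
proof (cases "x = y")
  case True
  then have "dist x z + dist z y = 0" using assms(5) by simp
  then have "dist x z = 0" using zero_le_dist[of x z] zero_le_dist[of z y] by linarith
  then have "dist x z = 0" "dist x z' = 0" using assms(7) by simp_all
  then show ?thesis by simp
next
  case False
  define t where "t = dist x z / dist x y"
  have t: "0 \<le> t" "t \<le> 1" using False order_trans[OF _ eq_refl[OF assms(5)], of "dist x z"]
      by (simp_all add: t_def divide_le_eq_1)
  obtain c where c: "cn_point X x y t c" using cat0_cn_point[OF cat0 assms(1,2) t] .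
  have 1: "dist x z = t * dist x y" using False by (simp add: t_def)
  have "dist z y = (1 - t) * dist x y" "dist z' y = (1 - t) * dist x y"
    using 1 assms(5-7) unfolding left_diff_distrib by linarith+
  with 1 assms(7) have "z = c" "z' = c"
    using cn_point_unique[OF c assms(3)] cn_point_unique[OF c assms(4)] by simp_all
  then show ?thesis by simp
qed

lemma convex_in_space: "convex_in X X"
  by (simp add: convex_in_def)

lemma convex_in_cball:
  assumes "a \<in> X"
  shows "convex_in X (X \<inter> cball a R)"
  unfolding convex_in_def
proof (intro conjI ballI impI)
  fix x y z assume xy: "x \<in> X \<inter> cball a R" "y \<in> X \<inter> cball a R" and z: "z \<in> X"
    and bet: "dist x z + dist z y = dist x y"
  show "z \<in> X \<inter> cball a R"
  proof (cases "x = y")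
    case True
    then have "dist x z + dist z y = 0" using bet by simp
    then have "dist x z = 0" using zero_le_dist[of x z] zero_le_dist[of z y] by linarith
    then show ?thesis using xy by simp
  next
    case False
    define t where "t = dist x z / dist x y"
    have t: "0 \<le> t" "t \<le> 1"
      using False order_trans[OF _ eq_refl[OF bet], of "dist x z"]
      by (simp_all add: t_def divide_le_eq_1)
    have R: "0 \<le> R" using xy(1) order_trans[OF zero_le_dist[of a x], of R] by simp
    obtain c where c: "cn_point X x y t c" using cat0_cn_point[OF cat0 _ _ t] xy by blast
    have 1: "dist x z = t * dist x y" using False by (simp add: t_def)
    have "dist z y = (1 - t) * dist x y"
      using 1 bet unfolding left_diff_distrib by linarith
    with 1 have "z = c" using cn_point_unique[OF c z] by simp
    then have "(dist a z)\<^sup>2 \<le> (1 - t) * (dist a x)\<^sup>2 + t * (dist a y)\<^sup>2 - t * (1 - t) * (dist x y)\<^sup>2"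
      using c assms by (simp add: cn_point_def)
    also have "\<dots> \<le> (1 - t) * R\<^sup>2 + t * R\<^sup>2 - 0"
      using xy t by (intro diff_mono add_mono mult_left_mono power_mono) auto
    also have "\<dots> = R\<^sup>2" by (simp add: algebra_simps)
    finally have "dist a z \<le> R" using R by (rule power2_le_imp_le)
    then show ?thesis using z by simp
  qed
qed auto

end

section \<open>Nearest points and barycentres\<close>

definition moment :: "'e set \<Rightarrow> ('e \<Rightarrow> 'x::metric_space) \<Rightarrow> ('e \<Rightarrow> real) \<Rightarrow> 'x \<Rightarrow> real" where
  "moment E p w x = (\<Sum>e\<in>E. w e * (dist x (p e))\<^sup>2)"

definition prob_weights :: "'e set \<Rightarrow> ('e \<Rightarrow> real) \<Rightarrow> bool" where
  "prob_weights E w \<longleftrightarrow> (\<forall>e\<in>E. 0 \<le> w e) \<and> sum w E = 1"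

context hadamard_space
begin

lemma moment_cn_point:
  assumes "prob_weights E w" "p ` E \<subseteq> X" "cn_point X x y t z"
  shows "moment E p w z \<le> (1 - t) * moment E p w x + t * moment E p w y - t * (1 - t) * (dist x y)\<^sup>2"
proof -
  have "moment E p w z \<le> (\<Sum>e\<in>E. w e * ((1 - t) * (dist x (p e))\<^sup>2 + t * (dist y (p e))\<^sup>2
          - t * (1 - t) * (dist x y)\<^sup>2))"
    unfolding moment_def using assms unfolding cn_point_def prob_weights_def
    by (intro sum_mono mult_left_mono) (auto simp: dist_commute[of _ "p e" for e])
  also have "\<dots> = (1 - t) * moment E p w x + t * moment E p w y - sum w E * (t * (1 - t) * (dist x y)\<^sup>2)"
    unfolding moment_def sum_distrib_left sum_distrib_right sum_subtractf[symmetric] sum.distrib[symmetric]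
    by (intro sum.cong) (auto simp: algebra_simps)
  finally show ?thesis using assms by (simp add: prob_weights_def)
qed

text \<open>Strong convexity makes minimising sequences Cauchy. It also gives quadratic growth away from
  the minimum: compare the minimum with points of the geodesic to \<open>x\<close> that tend to \<open>b\<close>.\<close>

lemma moment_minimiser:
  assumes w: "prob_weights E w" "p ` E \<subseteq> X" and C: "complete C" "convex_in X C" "C \<noteq> {}"
  obtains b where "b \<in> C" "\<And>x. x \<in> C \<Longrightarrow> moment E p w b + (dist x b)\<^sup>2 \<le> moment E p w x"
proof -
  let ?F = "moment E p w"
  have CX: "C \<subseteq> X" using C by (simp add: convex_in_def)
  have pos: "0 \<le> ?F x" for x
    using w by (auto simp: moment_def prob_weights_def intro!: sum_nonneg)
  have bdd: "bdd_below (?F ` C)" by (rule bdd_belowI2[of _ 0]) (rule pos)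
  define m where "m = Inf (?F ` C)"
  have m: "m \<le> ?F x" if "x \<in> C" for x
    unfolding m_def using bdd that by (simp add: cINF_lower)
  have cn: "\<exists>z\<in>C. ?F z \<le> (1 - t) * ?F x + t * ?F y - t * (1 - t) * (dist x y)\<^sup>2"
    if xy: "x \<in> C" "y \<in> C" and t: "0 \<le> t" "t \<le> 1" for x y t
  proof -
    obtain z where z: "cn_point X x y t z" using cat0_cn_point[OF cat0] xy t CX by blast
    have "dist x z + dist z y = dist x y"
      using cn_point_dist[OF z _ _ t] xy CX by (simp add: subset_eq algebra_simps)
    then have "z \<in> C" using convex_inD[OF C(2) xy] z by (simp add: cn_point_def)
    then show ?thesis using moment_cn_point[OF w z] by blast
  qed
  have close: "(dist x y)\<^sup>2 \<le> 4 * r" if xy: "x \<in> C" "y \<in> C" "?F x \<le> m + r" "?F y \<le> m + r" for x y r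
  proof -
    (* Two almost-minimal points are close, as otherwise their midpoint would go below the infimum. *)
    obtain z where "z \<in> C" "?F z \<le> (1 - 1/2) * ?F x + 1/2 * ?F y - 1/2 * (1 - 1/2) * (dist x y)\<^sup>2"
      using cn[OF xy(1,2), of "1/2"] by auto
    then show ?thesis using m[of z] xy by (simp add: field_simps)
  qed
  have "\<exists>x\<in>C. ?F x < m + inverse (Suc n)" for n
    using cINF_less_iff[OF C(3) bdd, of "m + inverse (Suc n)"] by (simp add: m_def)
  then obtain s where s: "\<And>n. s n \<in> C" "\<And>n. ?F (s n) < m + inverse (Suc n)" by metis
  have "Cauchy s"
  proof (rule metric_CauchyI)
    fix e :: real assume "e > 0"
    then obtain N where N: "inverse (real (Suc N)) < e\<^sup>2 / 4"
      using reals_Archimedean[of "e\<^sup>2 / 4"] by auto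
    have "dist (s i) (s j) < e" if "i \<ge> N" "j \<ge> N" for i j
    proof -
      have "inverse (real (Suc i)) \<le> inverse (Suc N)" "inverse (real (Suc j)) \<le> inverse (Suc N)"
        using that by (auto intro!: le_imp_inverse_le)
      then have "(dist (s i) (s j))\<^sup>2 \<le> 4 * inverse (Suc N)"
        using s(2)[of i] s(2)[of j] by (intro close s) linarith+
      also have "\<dots> < e\<^sup>2" using N by simp
      finally show ?thesis using \<open>e > 0\<close> by (simp add: power2_less_imp_less)
    qed
    then show "\<exists>M. \<forall>i\<ge>M. \<forall>j\<ge>M. dist (s i) (s j) < e" by blast
  qed
  then obtain b where b: "b \<in> C" "s \<longlonglongrightarrow> b"
    using C(1) s(1) unfolding complete_def by blast
  have "(\<lambda>n. ?F (s n)) \<longlonglongrightarrow> ?F b"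
    unfolding moment_def by (intro tendsto_intros b)
  moreover have "(\<lambda>n. m + inverse (Suc n)) \<longlonglongrightarrow> m + 0"
    by (intro tendsto_intros LIMSEQ_inverse_real_of_nat)
  ultimately have "?F b \<le> m + 0"
    by (rule LIMSEQ_le) (use s(2) in \<open>auto intro!: less_imp_le\<close>)
  then have Fb: "?F b \<le> ?F x" if "x \<in> C" for x using m[OF that] by simp
  have "?F b + (dist x b)\<^sup>2 \<le> ?F x" if x: "x \<in> C" for x
  proof -
    have "(dist b x)\<^sup>2 \<le> ?F x - ?F b"
    proof (rule field_le_mult_one_interval)
      fix r :: real assume r: "0 < r" "r < 1"
      obtain z where z: "z \<in> C" 
        "?F z \<le> (1 - (1 - r)) * ?F b + (1 - r) * ?F x - (1 - r) * (1 - (1 - r)) * (dist b x)\<^sup>2"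
        using cn[OF b(1) x, of "1 - r"] r by auto
      have "(1 - r) * (r * (dist b x)\<^sup>2) \<le> (1 - r) * (?F x - ?F b)"
        using z Fb[OF z(1)] by (simp add: algebra_simps)
      then show "r * (dist b x)\<^sup>2 \<le> ?F x - ?F b" using r by simp
    qed
    then show ?thesis by (simp add: dist_commute)
  qed
  then show ?thesis using that b(1) by blast
qed

text \<open>The moment of a single unit mass at \<open>a\<close> is the squared distance to \<open>a\<close>, so quadratic growth
  becomes an obtuse-angle inequality, which makes the nearest point unique.\<close>

lemma nearest_point:
  assumes C: "complete C" "convex_in X C" "C \<noteq> {}" and "a \<in> X"
  obtains b where "b \<in> C" "\<And>x. x \<in> C \<Longrightarrow> (dist b a)\<^sup>2 + (dist x b)\<^sup>2 \<le> (dist x a)\<^sup>2"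
proof -
  have "prob_weights {()} (\<lambda>_. 1)" by (simp add: prob_weights_def)
  from moment_minimiser[OF this _ C, of "\<lambda>_. a"] \<open>a \<in> X\<close> obtain b
    where "b \<in> C" "\<And>x. x \<in> C \<Longrightarrow> moment {()} (\<lambda>_. a) (\<lambda>_. 1) b + (dist x b)\<^sup>2 \<le> moment {()} (\<lambda>_. a) (\<lambda>_. 1) x"
    by blast
  then show ?thesis by (intro that) (simp_all add: moment_def)
qed

definition barycentre :: "'e set \<Rightarrow> ('e \<Rightarrow> 'x) \<Rightarrow> ('e \<Rightarrow> real) \<Rightarrow> 'x" where
  "barycentre E p w = (SOME b. b \<in> X \<and> (\<forall>x\<in>X. moment E p w b + (dist x b)\<^sup>2 \<le> moment E p w x))"

lemma barycentre:
  assumes "prob_weights E w" "p ` E \<subseteq> X"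
  shows "barycentre E p w \<in> X"
    and "x \<in> X \<Longrightarrow> moment E p w (barycentre E p w) + (dist x (barycentre E p w))\<^sup>2 \<le> moment E p w x"
proof -
  have "X \<noteq> {}" using cat0 by (simp add: cat0_space_def)
  then have "\<exists>b. b \<in> X \<and> (\<forall>x\<in>X. moment E p w b + (dist x b)\<^sup>2 \<le> moment E p w x)"
    using moment_minimiser[OF assms complete_space convex_in_space] by metis
  from someI_ex[OF this, folded barycentre_def]
  show "barycentre E p w \<in> X"
    "x \<in> X \<Longrightarrow> moment E p w (barycentre E p w) + (dist x (barycentre E p w))\<^sup>2 \<le> moment E p w x"
    by auto
qed

text \<open>Moving the barycentre to the nearest point of \<open>C\<close> decreases its distance to every point of
  \<open>C\<close>, hence does not increase the moment; by uniqueness of the minimiser nothing has moved.\<close>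

lemma barycentre_in_convex:
  assumes w: "prob_weights E w" "p ` E \<subseteq> X" and C: "complete C" "convex_in X C"
    and p: "\<And>e. e \<in> E \<Longrightarrow> 0 < w e \<Longrightarrow> p e \<in> C"
  shows "barycentre E p w \<in> C"
proof -
  let ?b = "barycentre E p w"
  have "\<exists>e\<in>E. 0 < w e"
  proof (rule ccontr)
    assume "\<not> ?thesis"
    then have "sum w E \<le> 0" by (intro sum_nonpos) force
    then show False using w by (simp add: prob_weights_def)
  qed
  then have "C \<noteq> {}" using p by blast
  then obtain c where c: "c \<in> C" "\<And>x. x \<in> C \<Longrightarrow> (dist c ?b)\<^sup>2 + (dist x c)\<^sup>2 \<le> (dist x ?b)\<^sup>2"
    using nearest_point[OF C _ barycentre(1)[OF w]] by metis
  have "moment E p w c + (dist c ?b)\<^sup>2 = (\<Sum>e\<in>E. w e * ((dist c (p e))\<^sup>2 + (dist c ?b)\<^sup>2))"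
    using w by (simp add: moment_def distrib_left sum.distrib prob_weights_def flip: sum_distrib_right)
  also have "\<dots> \<le> moment E p w ?b"
    unfolding moment_def
  proof (rule sum_mono)
    fix e assume e: "e \<in> E"
    show "w e * ((dist c (p e))\<^sup>2 + (dist c ?b)\<^sup>2) \<le> w e * (dist ?b (p e))\<^sup>2"
    proof (cases "w e = 0")
      case False
      then have "0 < w e" using w e by (force simp: prob_weights_def)
      then show ?thesis using c(2)[OF p[OF e]] by (simp add: dist_commute)
    qed simp
  qed
  also have "\<dots> + (dist c ?b)\<^sup>2 \<le> moment E p w c"
    using barycentre(2)[OF w, of c] c(1) C(2) by (auto simp: convex_in_def)
  finally have "(dist c ?b)\<^sup>2 \<le> 0" by simp
  then show ?thesis using c(1) by simp
qed

text \<open>The balls about the points \<open>p e\<close> whose radius is at least all mutual distances are convex and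
  contain every point.\<close>

lemma barycentre_bounded:
  assumes "finite E" "p ` E \<subseteq> X"
  obtains D where "\<And>w e. prob_weights E w \<Longrightarrow> e \<in> E \<Longrightarrow> dist (barycentre E p w) (p e) \<le> D"
proof -
  define D where "D = (\<Sum>e\<in>E. \<Sum>e'\<in>E. dist (p e) (p e'))"
  have D: "dist (p e) (p e') \<le> D" if "e \<in> E" "e' \<in> E" for e e'
  proof -
    have "dist (p e) (p e') \<le> (\<Sum>e'\<in>E. dist (p e) (p e'))"
      using assms(1) that by (intro member_le_sum) auto
    also have "\<dots> \<le> D"
      unfolding D_def using assms(1) that
      by (intro member_le_sum[where f="\<lambda>e. \<Sum>e'\<in>E. dist (p e) (p e')"]) (auto intro: sum_nonneg)
    finally show ?thesis .
  qed
  have "dist (barycentre E p w) (p e) \<le> D" if w: "prob_weights E w" and e: "e \<in> E" for w e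
  proof -
    have "complete (X \<inter> cball (p e) D)"
      using complete_space by (simp add: complete_Int_closed)
    moreover have "convex_in X (X \<inter> cball (p e) D)"
      using convex_in_cball assms e by blast
    ultimately have "barycentre E p w \<in> X \<inter> cball (p e) D"
      using w assms D e by (intro barycentre_in_convex) auto
    then show ?thesis by (simp add: dist_commute)
  qed
  then show ?thesis using that by blast
qed

text \<open>Adding the two growth inequalities at the other barycentre leaves a sum over the differences of
  the weights, with coefficients bounded by \<open>barycentre_bounded\<close>.\<close>

lemma barycentre_dist:
  assumes "finite E" "p ` E \<subseteq> X" 
  obtains D where "\<And>w w'. prob_weights E w \<Longrightarrow> prob_weights E w' \<Longrightarrow>
      (dist (barycentre E p w) (barycentre E p w'))\<^sup>2 \<le> D * (\<Sum>e\<in>E. \<bar>w e - w' e\<bar>)"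
proof -
  obtain D where D: "\<And>w e. prob_weights E w \<Longrightarrow> e \<in> E \<Longrightarrow> dist (barycentre E p w) (p e) \<le> D"
    using barycentre_bounded[OF assms] by blast
  have "(dist (barycentre E p w) (barycentre E p w'))\<^sup>2 \<le> D\<^sup>2 * (\<Sum>e\<in>E. \<bar>w e - w' e\<bar>)"
    if w: "prob_weights E w" "prob_weights E w'" for w w'
  proof -
    let ?b = "barycentre E p w" and ?b' = "barycentre E p w'"
    have "2 * (dist ?b ?b')\<^sup>2 \<le> (moment E p w ?b' - moment E p w ?b) + (moment E p w' ?b - moment E p w' ?b')"
      using barycentre(2)[OF w(1) assms(2) barycentre(1)[OF w(2) assms(2)]]
            barycentre(2)[OF w(2) assms(2) barycentre(1)[OF w(1) assms(2)]]
      by (simp add: dist_commute)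
    also have "\<dots> = (\<Sum>e\<in>E. (w e - w' e) * ((dist ?b' (p e))\<^sup>2 - (dist ?b (p e))\<^sup>2))"
      unfolding moment_def sum_subtractf[symmetric] sum.distrib[symmetric]
      by (intro sum.cong) (auto simp: algebra_simps)
    also have "\<dots> \<le> (\<Sum>e\<in>E. D\<^sup>2 * \<bar>w e - w' e\<bar>)"
    proof (rule sum_mono)
      fix e assume e: "e \<in> E"
      have "(dist ?b' (p e))\<^sup>2 \<le> D\<^sup>2" "(dist ?b (p e))\<^sup>2 \<le> D\<^sup>2"
        using D[OF w(1) e] D[OF w(2) e] by (simp_all add: power_mono)
      then have "\<bar>(dist ?b' (p e))\<^sup>2 - (dist ?b (p e))\<^sup>2\<bar> \<le> D\<^sup>2" 
        using zero_le_power2[of "dist ?b' (p e)"] zero_le_power2[of "dist ?b (p e)"] by linarith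
      then have "\<bar>w e - w' e\<bar> * \<bar>(dist ?b' (p e))\<^sup>2 - (dist ?b (p e))\<^sup>2\<bar> \<le> \<bar>w e - w' e\<bar> * D\<^sup>2"
        by (intro mult_left_mono) auto
      then show "(w e - w' e) * ((dist ?b' (p e))\<^sup>2 - (dist ?b (p e))\<^sup>2) \<le> D\<^sup>2 * \<bar>w e - w' e\<bar>"
        by (simp add: mult.commute flip: abs_mult)
    qed
    also have "\<dots> = D\<^sup>2 * (\<Sum>e\<in>E. \<bar>w e - w' e\<bar>)" by (simp add: sum_distrib_left)
    finally show ?thesis using zero_le_power2[of "dist ?b ?b'"] by linarith
  qed
  then show ?thesis using that by blast
qed

lemma continuous_map_barycentre:
  assumes "finite E" "p ` E \<subseteq> X" 
    and w: "\<And>v. v \<in> topspace T \<Longrightarrow> prob_weights E (w v)"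
    and cont: "\<And>e. e \<in> E \<Longrightarrow> continuous_map T euclideanreal (\<lambda>v. w v e)"
  shows "continuous_map T (top_of_set X) (\<lambda>v. barycentre E p (w v))"
proof -
  obtain D where D: "\<And>w w'. prob_weights E w \<Longrightarrow> prob_weights E w' \<Longrightarrow>
      (dist (barycentre E p w) (barycentre E p w'))\<^sup>2 \<le> D * (\<Sum>e\<in>E. \<bar>w e - w' e\<bar>)"
    using barycentre_dist[OF assms(1,2)] by blast
  have "continuous_map T euclidean (\<lambda>v. barycentre E p (w v))"
    unfolding continuous_map_atin limitin_canonical_iff
  proof
    fix v assume v: "v \<in> topspace T"
    have "((\<lambda>u. w u e) \<longlongrightarrow> w v e) (atin T v)" if "e \<in> E" for e
      using cont[OF that] v by (simp add: continuous_map_atin)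
    then have "((\<lambda>u. D * (\<Sum>e\<in>E. \<bar>w u e - w v e\<bar>)) \<longlongrightarrow> D * (\<Sum>e\<in>E. \<bar>w v e - w v e\<bar>)) (atin T v)"
      by (intro tendsto_intros)
    then have lim: "((\<lambda>u. D * (\<Sum>e\<in>E. \<bar>w u e - w v e\<bar>)) \<longlongrightarrow> 0) (atin T v)" by simp
    have "((\<lambda>u. (dist (barycentre E p (w u)) (barycentre E p (w v)))\<^sup>2) \<longlongrightarrow> 0) (atin T v)"
    proof (rule tendsto_sandwich[OF _ _ tendsto_const lim])
      have ev: "\<forall>\<^sub>F u in atin T v. u \<in> topspace T" 
        using eventually_atin v openin_topspace by fastforce
      show "\<forall>\<^sub>F u in atin T v. (dist (barycentre E p (w u)) (barycentre E p (w v)))\<^sup>2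
              \<le> D * (\<Sum>e\<in>E. \<bar>w u e - w v e\<bar>)"
        using ev by eventually_elim (use D w v in blast)
    qed auto
    then have "((\<lambda>u. sqrt ((dist (barycentre E p (w u)) (barycentre E p (w v)))\<^sup>2)) \<longlongrightarrow> sqrt 0) (atin T v)"
      by (rule tendsto_real_sqrt)
    then show "((\<lambda>u. barycentre E p (w u)) \<longlongrightarrow> barycentre E p (w v)) (atin T v)"
      by (subst tendsto_dist_iff) simp
  qed
  then show ?thesis
    using w barycentre(1)[OF _ assms(2)] by (auto simp: continuous_map_in_subtopology)
qed

end

section \<open>Maps of spheres\<close>

lemma in_topspace_nsphere_iff:
  "v \<in> topspace (nsphere r) \<longleftrightarrow> (\<Sum>i\<le>r. (v i)\<^sup>2) = 1 \<and> (\<forall>i>r. v i = 0)"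
  by (simp add: nsphere)

definition normalise :: "nat \<Rightarrow> (nat \<Rightarrow> real) \<Rightarrow> nat \<Rightarrow> real" where
  "normalise r y = (\<lambda>k. if k \<le> r then y k / sqrt (\<Sum>i\<le>r. (y i)\<^sup>2) else 0)"

lemma sum_squares_pos:
  fixes y :: "nat \<Rightarrow> real"
  assumes "k \<le> r" "y k \<noteq> 0"
  shows "0 < (\<Sum>i\<le>r. (y i)\<^sup>2)"
  using assms by (intro sum_pos2[of _ k]) auto

lemma normalise_nsphere: "v \<in> topspace (nsphere r) \<Longrightarrow> normalise r v = v"
  by (auto simp: normalise_def in_topspace_nsphere_iff fun_eq_iff)

lemma continuous_map_normalise:
  assumes cont: "\<And>k. k \<le> r \<Longrightarrow> continuous_map T euclideanreal (\<lambda>x. h x k)"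
    and nz: "\<And>x. x \<in> topspace T \<Longrightarrow> \<exists>k\<le>r. h x k \<noteq> 0"
  shows "continuous_map T (nsphere r) (\<lambda>x. normalise r (h x))"
proof -
  have pos: "0 < (\<Sum>i\<le>r. (h x i)\<^sup>2)" if "x \<in> topspace T" for x
    using nz[OF that] sum_squares_pos by blast
  have "continuous_map T euclideanreal (\<lambda>x. normalise r (h x) k)" for k
  proof (cases "k \<le> r")
    case True
    have "continuous_map T euclideanreal (\<lambda>x. h x k / sqrt (\<Sum>i\<le>r. (h x i)\<^sup>2))"
    proof (intro continuous_map_real_divide continuous_map_sqrt continuous_map_sum continuous_map_real_pow)
      show "continuous_map T euclideanreal (\<lambda>x. h x k)" using cont True by blast
      show "continuous_map T euclideanreal (\<lambda>x. h x i)" if "i \<in> {..r}" for i using cont that by simp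
      show "sqrt (\<Sum>i\<le>r. (h x i)\<^sup>2) \<noteq> 0" if "x \<in> topspace T" for x using pos[OF that] by simp
    qed simp
    then show ?thesis using True by (simp add: normalise_def)
  qed (simp add: normalise_def)
  moreover have "normalise r (h x) \<in> topspace (nsphere r)" if "x \<in> topspace T" for x
    using pos[OF that] by (simp add: in_topspace_nsphere_iff normalise_def power_divide flip: sum_divide_distrib)
  ultimately show ?thesis
    unfolding nsphere continuous_map_in_subtopology continuous_map_componentwise_UNIV
    by (force simp: nsphere)
qed

text \<open>Without antipodal values the straight-line homotopy to the identity misses the origin, and the
  sphere would be contractible.\<close>

lemma nullhomotopic_sphere_map_has_antipodal_value:
  assumes g: "continuous_map (nsphere r) (nsphere r) g"
    and null: "homotopic_with (\<lambda>_. True) (nsphere r) (nsphere r) g (\<lambda>_. a)"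
  shows "\<exists>v\<in>topspace (nsphere r). g v = (\<lambda>k. - v k)"
proof (rule ccontr)
  assume no: "\<not> ?thesis"
  let ?T = "prod_topology (top_of_set {0..1::real}) (nsphere r)"
  define h where "h = (\<lambda>(t::real, v) k. (1 - t) * v k + t * g v k)"
  have "continuous_map ?T (nsphere r) (\<lambda>x. normalise r (h x))"
  proof (rule continuous_map_normalise)
    fix k assume "k \<le> r"
    have p1: "continuous_map (nsphere r) euclideanreal (\<lambda>v. v k)"
      by (rule continuous_map_nsphere_projection)
    have fst: "continuous_map ?T euclideanreal fst"
      by (metis continuous_map_fst continuous_map_into_fulltopology)
    have "continuous_map ?T euclideanreal ((\<lambda>v. v k) \<circ> snd)"
      "continuous_map ?T euclideanreal ((\<lambda>v. v k) \<circ> (g \<circ> snd))"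
      using continuous_map_compose[OF continuous_map_snd p1]
        continuous_map_compose[OF continuous_map_compose[OF continuous_map_snd g] p1] by auto
    with fst have "continuous_map ?T euclideanreal (\<lambda>x. (1 - fst x) * (snd x k) + fst x * g (snd x) k)"
      by (intro continuous_map_add continuous_map_real_mult continuous_map_diff) (simp_all add: o_def)
    then show "continuous_map ?T euclideanreal (\<lambda>x. h x k)"
      by (simp add: h_def case_prod_unfold)
  next
    fix x assume "x \<in> topspace ?T"
    then obtain t v where x: "x = (t, v)" and t: "0 \<le> t" "t \<le> 1" and v: "v \<in> topspace (nsphere r)"
      by (cases x) (simp add: topspace_prod_topology)
    have gv: "g v \<in> topspace (nsphere r)"
      using g v by (auto simp: continuous_map_def)
    show "\<exists>k\<le>r. h x k \<noteq> 0"
    proof (rule ccontr)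
      assume "\<not> ?thesis"
      then have *: "(1 - t) * v k = - (t * g v k)" if "k \<le> r" for k
        using that by (auto simp: h_def x add_eq_0_iff)
      have "(1 - t)\<^sup>2 * (\<Sum>k\<le>r. (v k)\<^sup>2) = (\<Sum>k\<le>r. ((1 - t) * v k)\<^sup>2)"
        by (simp add: power_mult_distrib sum_distrib_left)
      also have "\<dots> = (\<Sum>k\<le>r. (t * g v k)\<^sup>2)" using * by simp
      also have "\<dots> = t\<^sup>2 * (\<Sum>k\<le>r. (g v k)\<^sup>2)"
        by (simp add: power_mult_distrib sum_distrib_left)
      finally have "(1 - t)\<^sup>2 = t\<^sup>2" using v gv by (simp add: in_topspace_nsphere_iff)
      then have "t = 1/2" using t by (simp add: power2_eq_square algebra_simps)
      then have "g v k = - v k" for k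
        using *[of k] v gv unfolding in_topspace_nsphere_iff \<open>t = 1/2\<close> by (cases "k \<le> r") simp_all
      then show False using no v by blast
    qed
  qed
  moreover have "normalise r (h (0, v)) = id v" "normalise r (h (1, v)) = g v"
    if "v \<in> topspace (nsphere r)" for v
    using that g normalise_nsphere[of v r] normalise_nsphere[of "g v" r]
    by (auto simp: h_def continuous_map_def)
  ultimately have "homotopic_with (\<lambda>_. True) (nsphere r) (nsphere r) id g"
    by (subst homotopic_with) (auto intro!: exI[of _ "\<lambda>x. normalise r (h x)"])
  then have "homotopic_with (\<lambda>_. True) (nsphere r) (nsphere r) id (\<lambda>_. a)"
    using null by (rule homotopic_with_trans)
  then have "contractible_space (nsphere r)" by (auto simp: contractible_space_def)
  then show False by (simp add: non_contractible_space_nsphere)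
qed

section \<open>Barycentric weights on a product of simplices\<close>

text \<open>A vector \<open>w\<close> with one block of coordinates per simplex is moved into the boundary of the
  product of simplices, up to scaling: each block is centred at its mean, and then all
  coordinates are shifted by one number so that the smallest of them becomes zero. The shift is common to all
  blocks, so every block has the same sum, which is positive unless all blocks are constant.\<close>

definition centred :: "'s set \<Rightarrow> ('i \<Rightarrow> 's \<Rightarrow> real) \<Rightarrow> 'i \<Rightarrow> 's \<Rightarrow> real" where
  "centred S w i s = w i s - sum (w i) S / card S"

definition slack :: "'i set \<Rightarrow> 's set \<Rightarrow> ('i \<Rightarrow> 's \<Rightarrow> real) \<Rightarrow> 'i \<Rightarrow> 's \<Rightarrow> real" where
  "slack I S w i s = centred S w i s - (INF (j, t) \<in> I \<times> S. centred S w j t)"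

text \<open>The product of the barycentric coordinates of the simplices, which is a system of weights on the
  vertices \<open>e\<close> of their product.\<close>

definition vertex_weight :: "'i set \<Rightarrow> 's set \<Rightarrow> ('i \<Rightarrow> 's \<Rightarrow> real) \<Rightarrow> ('i \<Rightarrow> 's) \<Rightarrow> real" where
  "vertex_weight I S w e = (\<Prod>i\<in>I. slack I S w i (e i)) / (\<Prod>i\<in>I. \<Sum>s\<in>S. slack I S w i s)"

lemma slack_nonneg:
  assumes "finite I" "finite S" "i \<in> I" "s \<in> S"
  shows "0 \<le> slack I S w i s"
proof -
  have "(INF (j, t) \<in> I \<times> S. centred S w j t) \<le> (case (i, s) of (j, t) \<Rightarrow> centred S w j t)"
    using assms by (intro cINF_lower) (auto intro!: bdd_below_finite)
  then show ?thesis by (simp add: slack_def)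
qed

text \<open>The point lies on a facet of the product, namely one whose coordinate is the least of its block.\<close>

lemma slack_eq_0:
  assumes "finite I" "finite S" "I \<noteq> {}" "S \<noteq> {}"
  obtains i s where "i \<in> I" "s \<in> S" "slack I S w i s = 0" "\<And>t. t \<in> S \<Longrightarrow> w i s \<le> w i t"
proof -
  let ?A = "(\<lambda>(j, t). centred S w j t) ` (I \<times> S)"
  have A: "finite ?A" "?A \<noteq> {}" using assms by auto
  then have "Inf ?A \<in> ?A" unfolding cInf_eq_Min[OF A] by (rule Min_in)
  then obtain i s where ist: "i \<in> I" "s \<in> S" "slack I S w i s = 0"
    by (auto simp: slack_def)
  have "w i s \<le> w i t" if "t \<in> S" for t
    using slack_nonneg[OF assms(1,2) ist(1) that, of w] ist(3) by (simp add: slack_def centred_def)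
  then show ?thesis using ist that by blast
qed

lemma sum_centred:
  assumes "finite S" "S \<noteq> {}"
  shows "(\<Sum>s\<in>S. centred S w i s) = 0"
  using assms by (simp add: centred_def sum_subtractf)

text \<open>All centred blocks sum to zero, so a non-constant block has a negative entry. Hence the common
  shift is strictly positive, and it is the mean slack of every block.\<close>

lemma sum_slack_pos:
  assumes fin: "finite I" "finite S" and i: "i \<in> I"
    and nc: "j \<in> I" "s \<in> S" "t \<in> S" "w j s \<noteq> w j t"
  shows "0 < (\<Sum>s\<in>S. slack I S w i s)"
proof -
  have S: "S \<noteq> {}" using nc by blast
  let ?m = "INF (j, t) \<in> I \<times> S. centred S w j t"
  have "?m < 0"
  proof (rule ccontr)
    assume m: "\<not> ?m < 0"
    have nn: "0 \<le> centred S w j u" if "u \<in> S" for u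
      using slack_nonneg[OF fin nc(1) that, of w] m by (simp add: slack_def)
    have "\<forall>u\<in>S. centred S w j u = 0"
      using sum_centred[OF fin(2) S, of w j] nn fin(2) by (subst (asm) sum_nonneg_eq_0_iff) auto
    then have "centred S w j s = centred S w j t" using nc(2,3) by metis
    then show False using nc(4) by (simp add: centred_def)
  qed
  then have "0 < card S * (- ?m)" using fin S by (intro mult_pos_pos) (simp_all add: card_gt_0_iff)
  also have "\<dots> = (\<Sum>s\<in>S. slack I S w i s)"
    using sum_centred[OF fin(2) S, of w i] by (simp add: slack_def sum_subtractf)
  finally show ?thesis .
qed

lemma prob_weights_vertex_weight:
  assumes fin: "finite I" "finite S" and nc: "j \<in> I" "s \<in> S" "t \<in> S" "w j s \<noteq> w j t"
  shows "prob_weights (I \<rightarrow>\<^sub>E S) (vertex_weight I S w)"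
  unfolding prob_weights_def
proof
  have pos: "0 < (\<Prod>i\<in>I. \<Sum>s\<in>S. slack I S w i s)"
    using sum_slack_pos[where w = w, OF fin _ nc] by (intro prod_pos) auto
  show "\<forall>e\<in>I \<rightarrow>\<^sub>E S. 0 \<le> vertex_weight I S w e"
    using slack_nonneg[OF fin] pos unfolding vertex_weight_def
    by (auto intro!: divide_nonneg_pos prod_nonneg)
  have "(\<Sum>e\<in>I \<rightarrow>\<^sub>E S. \<Prod>i\<in>I. slack I S w i (e i)) = (\<Prod>i\<in>I. \<Sum>s\<in>S. slack I S w i s)"
    using fin by (subst prod_sum_PiE) auto
  then show "sum (vertex_weight I S w) (I \<rightarrow>\<^sub>E S) = 1"
    using pos by (simp add: vertex_weight_def flip: sum_divide_distrib)
qed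

text \<open>The vertices with \<open>e i = s\<close> are those off the facet \<open>(i, s)\<close>.\<close>

lemma vertex_weight_eq_0:
  assumes "finite I" "i \<in> I" "slack I S w i (e i) = 0"
  shows "vertex_weight I S w e = 0"
  using assms by (auto simp: vertex_weight_def)

lemma continuous_map_vertex_weight:
  assumes fin: "finite I" "finite S" and e: "e \<in> I \<rightarrow>\<^sub>E S"
    and cont: "\<And>i s. i \<in> I \<Longrightarrow> s \<in> S \<Longrightarrow> continuous_map T euclideanreal (\<lambda>v. w v i s)"
    and nc: "\<And>v. v \<in> topspace T \<Longrightarrow> \<exists>j\<in>I. \<exists>s\<in>S. \<exists>t\<in>S. w v j s \<noteq> w v j t"
  shows "continuous_map T euclideanreal (\<lambda>v. vertex_weight I S (w v) e)"
proof -
  have c: "continuous_map T euclideanreal (\<lambda>v. centred S (w v) i s)" if "i \<in> I" "s \<in> S" for i s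
  proof (cases "card S = 0")
    case False
    then show ?thesis unfolding centred_def using fin cont that
      by (intro continuous_map_diff continuous_map_real_divide continuous_map_sum) auto
  qed (use fin that in auto)
  have s: "continuous_map T euclideanreal (\<lambda>v. slack I S (w v) i s)" if "i \<in> I" "s \<in> S" for i s
    unfolding slack_def case_prod_unfold using fin c that
    by (intro continuous_map_diff continuous_map_Inf) auto
  show ?thesis
    unfolding vertex_weight_def
  proof (intro continuous_map_real_divide continuous_map_prod continuous_map_sum s)
    show "e i \<in> S" if "i \<in> I" for i using e that by auto
    show "(\<Prod>i\<in>I. \<Sum>s\<in>S. slack I S (w v) i s) \<noteq> 0" if v: "v \<in> topspace T" for v
    proof -
      obtain j s t where "j \<in> I" "s \<in> S" "t \<in> S" "w v j s \<noteq> w v j t" using nc[OF v] by blast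
      from sum_slack_pos[where w = "w v", OF fin _ this] have "0 < (\<Prod>i\<in>I. \<Sum>s\<in>S. slack I S (w v) i s)"
        by (intro prod_pos) auto
      then show ?thesis by simp
    qed
  qed (use fin in auto)
qed

section \<open>A Helly theorem for blocks of convex sets\<close>

text \<open>The hypothesis \<open>vertex\<close> is about the vertex \<open>e\<close> of the product of simplices, which lies on
  precisely the facets \<open>(i, s)\<close> with \<open>s \<noteq> e i\<close>. With a single block this is the step of Helly's theorem
  from subfamilies of \<open>card S - 1\<close> sets to all of \<open>S\<close>.\<close>

theorem (in hadamard_space) block_helly:
  fixes C :: "'i \<Rightarrow> 's \<Rightarrow> 'x set"
  assumes dim: "covering_dim_le (top_of_set X) d"
    and fin: "finite I" "finite S" and card: "d < card I * (card S - 1)"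
    and C: "\<And>i s. i \<in> I \<Longrightarrow> s \<in> S \<Longrightarrow> complete (C i s)"
      "\<And>i s. i \<in> I \<Longrightarrow> s \<in> S \<Longrightarrow> convex_in X (C i s)"
    and vertex: "\<And>e. e \<in> I \<rightarrow>\<^sub>E S \<Longrightarrow> \<exists>x\<in>X. \<forall>i\<in>I. \<forall>s\<in>S - {e i}. x \<in> C i s"
  shows "\<exists>i\<in>I. \<exists>x\<in>X. \<forall>s\<in>S. x \<in> C i s"
proof (rule ccontr)
  assume "\<not> ?thesis"
  then have no: "\<exists>s\<in>S. x \<notin> C i s" if "i \<in> I" "x \<in> X" for i x using that by blast
  have "0 < card I * (card S - 1)" using card by linarith
  then have cards: "0 < card I" "1 < card S" by simp_all
  then have ne: "I \<noteq> {}" "S \<noteq> {}" by auto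
  then obtain s0 where s0: "s0 \<in> S" by blast
  have "finite (I \<times> (S - {s0}))" using fin by simp
  (* One coordinate of each block is normalised to 0, which leaves n * m = r + 1 free coordinates. *)
  define r where "r = card I * (card S - 1) - 1"
  have r: "d \<le> r" "card (I \<times> (S - {s0})) = Suc r"
    using card fin s0 by (auto simp: r_def card_cartesian_product)
  obtain coord where coord: "bij_betw coord {..r} (I \<times> (S - {s0}))"
    using ex_bij_betw_nat_finite[OF \<open>finite (I \<times> (S - {s0}))\<close>] r(2)
    by (metis atLeast0LessThan lessThan_Suc_atMost)
  define w where "w v i s = (if s = s0 then 0 else v (inv_into {..r} coord (i, s)))"
    for v :: "nat \<Rightarrow> real" and i s
  have w_coord: "w v (fst (coord k)) (snd (coord k)) = v k" if "k \<le> r" for v k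
    using bij_betw_apply[OF coord, of k] bij_betw_inv_into_left[OF coord, of k] that
    by (auto simp: w_def mem_Times_iff)
  have coord_surj: "\<exists>k\<le>r. coord k = (i, s)" if "i \<in> I" "s \<in> S" "s \<noteq> s0" for i s
  proof -
    have "(i, s) \<in> coord ` {..r}" using coord that by (simp add: bij_betw_def)
    then show ?thesis by force
  qed
  define E where "E = I \<rightarrow>\<^sub>E S"
  have finE: "finite E" unfolding E_def using fin by (intro finite_PiE) auto
  obtain p where p: "\<And>e. e \<in> E \<Longrightarrow> p e \<in> X" 
     "\<And>e i s. e \<in> E \<Longrightarrow> i \<in> I \<Longrightarrow> s \<in> S \<Longrightarrow> s \<noteq> e i \<Longrightarrow> p e \<in> C i s"
    using vertex unfolding E_def by (metis DiffI singletonD)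
  have pX: "p ` E \<subseteq> X" using p by blast
  have CX: "C i s \<subseteq> X" "closed (C i s)" if "i \<in> I" "s \<in> S" for i s
    using C that by (auto simp: convex_in_def complete_imp_closed)
  (* C i s contains the point of every vertex e with e i different from s. *)
  have Cne: "C i s \<noteq> {}" if "i \<in> I" "s \<in> S" for i s
  proof -
    have "\<not> S \<subseteq> {s}" using card_mono[of "{s}" S] cards(2) by auto
    then obtain t where t: "t \<in> S" "t \<noteq> s" by blast
    then have "restrict (\<lambda>_. t) I \<in> E" by (auto simp: E_def)
    from p(2)[OF this that] t that(1) show ?thesis by auto
  qed
  have in_C: "x \<in> C i s \<longleftrightarrow> infdist x (C i s) = 0" if "i \<in> I" "s \<in> S" for i s x
    using in_closed_iff_infdist_zero[OF CX(2)[OF that] Cne[OF that]] .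
  define K where "K = (\<Union>i\<in>I. \<Union>s\<in>S. C i s)"
  have "closed K" unfolding K_def using fin CX by (intro closed_UN) auto
  have "K \<subseteq> X" unfolding K_def using CX by blast
  (* On K the differences cannot all vanish: one distance is 0, so all of its block
     would be, and the block would have a common point. *)
  define u where "u x k =
      infdist x (C (fst (coord k)) (snd (coord k))) - infdist x (C (fst (coord k)) s0)" for x k
  have u_all: "infdist x (C i s) - infdist x (C i s0) = c * w v i s"
    if ux: "\<And>k. k \<le> r \<Longrightarrow> u x k = c * v k" and ist: "i \<in> I" "s \<in> S" for x v c i s
  proof (cases "s = s0")
    case False
    then obtain k where "k \<le> r" "coord k = (i, s)" using coord_surj[OF ist False] by blast
    then show ?thesis using ux[of k] w_coord[of k v] by (simp add: u_def)
  qed (simp add: w_def)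
  have u_nz: "\<exists>k\<le>r. u x k \<noteq> 0" if "x \<in> K" for x
  proof (rule ccontr)
    assume "\<not> ?thesis"
    then have all: "infdist x (C i s) = infdist x (C i s0)" if "i \<in> I" "s \<in> S" for i s
      using u_all[of x 0 "\<lambda>_. 0"] that by simp
    obtain i s where "i \<in> I" "s \<in> S" "x \<in> C i s" using \<open>x \<in> K\<close> by (auto simp: K_def)
    then have "x \<in> C i t" if "t \<in> S" for t
      using in_C[of i s] in_C[of i t] all[of i s] all[of i t] that by simp
    then show False using no[of i x] \<open>i \<in> I\<close> \<open>x \<in> K\<close> \<open>K \<subseteq> X\<close> by blast
  qed
  have "continuous_map (top_of_set K) (nsphere r) (\<lambda>x. normalise r (u x))"
    using u_nz unfolding u_def
    by (intro continuous_map_normalise) (auto intro!: continuous_intros)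
  moreover have "subtopology (top_of_set X) K = top_of_set K"
    using \<open>K \<subseteq> X\<close> by (simp add: subtopology_subtopology inf_absorb2)
  moreover have "closedin (top_of_set X) K"
    using \<open>K \<subseteq> X\<close> \<open>closed K\<close> by (simp add: closed_subset)
  ultimately obtain h where h: "continuous_map (top_of_set X) (nsphere r) h"
    and hK: "\<And>x. x \<in> K \<Longrightarrow> h x = normalise r (u x)"
    using dim[unfolded covering_dim_le_def, rule_format, of K r "\<lambda>x. normalise r (u x)"] r(1) by auto
  have w_nc: "\<exists>i\<in>I. \<exists>s\<in>S. \<exists>t\<in>S. w v i s \<noteq> w v i t" if v: "v \<in> topspace (nsphere r)" for v
  proof -
    have "\<exists>k\<le>r. v k \<noteq> 0"
    proof (rule ccontr)
      assume "\<not> ?thesis"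
      then have "(\<Sum>k\<le>r. (v k)\<^sup>2) = 0" by simp
      then show False using v by (simp add: in_topspace_nsphere_iff)
    qed
    then obtain k where k: "k \<le> r" "v k \<noteq> 0" by blast
    have "w v (fst (coord k)) (snd (coord k)) \<noteq> w v (fst (coord k)) s0"
      using w_coord[OF k(1)] k by (simp add: w_def)
    moreover have "coord k \<in> I \<times> (S - {s0})" using bij_betw_apply[OF coord] k(1) by simp
    ultimately show ?thesis using s0
      by (intro bexI[of _ "fst (coord k)"] bexI[of _ "snd (coord k)"] bexI[of _ s0]) (auto simp: mem_Times_iff)
  qed
  have "restrict (\<lambda>_. s0) I \<in> E" using s0 by (simp add: E_def)
  then obtain e0 where e0: "e0 \<in> E" by blast
  (* The homotopy moves all the weight linearly to a single vertex. *)
  define P where "P = (\<lambda>(t, v) e.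
      (1 - t) * vertex_weight I S (w v) e + t * (if e = e0 then 1 else 0))"
  have VP: "prob_weights E (vertex_weight I S (w v))" if v: "v \<in> topspace (nsphere r)" for v
  proof -
    obtain i s t where "i \<in> I" "s \<in> S" "t \<in> S" "w v i s \<noteq> w v i t" using w_nc[OF v] by blast
    from prob_weights_vertex_weight[where w = "w v", OF fin this] show ?thesis by (simp add: E_def)
  qed
  let ?T = "prod_topology (top_of_set {0..1::real}) (nsphere r)"
  have "continuous_map ?T (top_of_set X) (\<lambda>x. barycentre E p (P x))"
  proof (rule continuous_map_barycentre[OF finE pX])
    fix x assume "x \<in> topspace ?T"
    then obtain t v where x: "x = (t, v)" and t: "0 \<le> t" "t \<le> 1" and v: "v \<in> topspace (nsphere r)"
      by (cases x) (simp add: topspace_prod_topology)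
    show "prob_weights E (P x)"
      using VP[OF v] t e0 finE unfolding prob_weights_def P_def x
      by (simp add: sum.distrib flip: sum_distrib_left)
  next
    fix e assume e: "e \<in> E"
    have fst: "continuous_map ?T euclideanreal fst"
      by (metis continuous_map_fst continuous_map_into_fulltopology)
    have "continuous_map (nsphere r) euclideanreal (\<lambda>v. vertex_weight I S (w v) e)"
    proof (rule continuous_map_vertex_weight[OF fin])
      show "e \<in> I \<rightarrow>\<^sub>E S" using e by (simp add: E_def)
      show "continuous_map (nsphere r) euclideanreal (\<lambda>v. w v i s)" for i s
        using continuous_map_nsphere_projection by (cases "s = s0") (auto simp: w_def)
    qed (rule w_nc)
    from continuous_map_compose[OF continuous_map_snd this] fst
    show "continuous_map ?T euclideanreal (\<lambda>x. P x e)"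
      unfolding P_def case_prod_unfold
      by (intro continuous_map_add continuous_map_real_mult continuous_map_diff) (simp_all add: o_def)
  qed
  then have cont: "continuous_map ?T (nsphere r) (\<lambda>x. h (barycentre E p (P x)))"
    using continuous_map_compose[OF _ h] by (simp add: o_def)
  define g where "g v = h (barycentre E p (P (0, v)))" for v
  have "P (1, v) = (\<lambda>e. if e = e0 then 1 else 0)" for v by (simp add: P_def fun_eq_iff)
  then obtain a where "h (barycentre E p (P (1, v))) = a" for v by simp
  then have null: "homotopic_with (\<lambda>_. True) (nsphere r) (nsphere r) g (\<lambda>_. a)"
    unfolding homotopic_with_def g_def using cont
    by (intro exI[of _ "\<lambda>x. h (barycentre E p (P x))"]) simp
  then have "continuous_map (nsphere r) (nsphere r) g" by (simp add: homotopic_with_imp_continuous_maps)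
  then obtain v where v: "v \<in> topspace (nsphere r)" and gv: "g v = (\<lambda>k. - v k)"
    using nullhomotopic_sphere_map_has_antipodal_value[OF _ null] by blast
  define x where "x = barycentre E p (P (0, v))"
  have P0: "P (0, v) = vertex_weight I S (w v)" by (simp add: P_def fun_eq_iff)
  obtain i s where i: "i \<in> I" "s \<in> S" and sl: "slack I S (w v) i s = 0"
    and wmin: "\<And>t. t \<in> S \<Longrightarrow> w v i s \<le> w v i t"
    using slack_eq_0[OF fin ne, of "w v"] by blast
  have xC: "x \<in> C i s"
    unfolding x_def P0
  proof (rule barycentre_in_convex[OF VP[OF v] pX C(1)[OF i] C(2)[OF i]])
    fix e assume e: "e \<in> E" "0 < vertex_weight I S (w v) e"
    then have "e i \<noteq> s" using vertex_weight_eq_0[OF fin(1) i(1), of S "w v" e] sl by auto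
    then show "p e \<in> C i s" using p(2)[OF e(1) i] by blast
  qed
  then have xK: "x \<in> K" using i by (auto simp: K_def)
  then have xX: "x \<in> X" using \<open>K \<subseteq> X\<close> by blast
  have hx: "normalise r (u x) k = - v k" for k
    using fun_cong[OF gv, of k] hK[OF xK] by (simp add: g_def x_def)
  define N where "N = sqrt (\<Sum>k\<le>r. (u x k)\<^sup>2)"
  obtain k where "k \<le> r" "u x k \<noteq> 0" using u_nz[OF xK] by blast
  then have N: "0 < N" unfolding N_def using sum_squares_pos[of k r "u x"] by simp
  have uv: "u x k = - N * v k" if "k \<le> r" for k
    using hx[of k] that N by (simp add: normalise_def N_def[symmetric] field_simps)
  (* As h x = -v, the distances in block i decrease where the coordinates of v increase. The least
     coordinate s has distance 0, which is therefore also the largest distance of the block. *)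
  have "x \<in> C i t" if t: "t \<in> S" for t
  proof -
    have "infdist x (C i t) - infdist x (C i s) = N * (w v i s - w v i t)"
      using u_all[OF uv i(1) t] u_all[OF uv i(1,2)] by (simp add: algebra_simps)
    also have "\<dots> \<le> 0" using N wmin[OF t] by (simp add: mult_le_0_iff)
    finally have "infdist x (C i t) \<le> 0" using xC in_C[OF i] by simp
    then have "infdist x (C i t) = 0" using infdist_nonneg[of x "C i t"] by linarith
    then show ?thesis using in_C[OF i(1) t] by simp
  qed
  then show False using no[OF i(1) xX] by blast
qed

section \<open>Fixed points of isometric actions\<close>

lemma (in group) commuting_subgroupsD:
  assumes "commuting_subgroups G H1 H2" "g \<in> H1" "h \<in> H2" "g \<in> carrier G" "h \<in> carrier G"
  shows "g \<otimes> h = h \<otimes> g"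
proof -
  have "g \<otimes> h \<otimes> inv g \<otimes> inv h = \<one>" using assms by (simp add: commuting_subgroups_def)
  then have "g \<otimes> h \<otimes> inv (h \<otimes> g) = \<one>" using assms by (simp add: inv_mult_group m_assoc)
  then show ?thesis using assms by (metis inv_equality inv_inv m_closed inv_closed)
qed

locale hadamard_action = group G + hadamard_space X
  for G (structure) and X :: "'x::metric_space set" +
  fixes \<phi> :: "'a \<Rightarrow> 'x \<Rightarrow> 'x"
  assumes action: "isometric_action G X \<phi>"
begin

sublocale group_action G X \<phi>
  using action by (simp add: isometric_action_def)

lemma act_closed: "g \<in> carrier G \<Longrightarrow> x \<in> X \<Longrightarrow> \<phi> g x \<in> X"
  using element_image by blast

lemma dist_act: "g \<in> carrier G \<Longrightarrow> x \<in> X \<Longrightarrow> y \<in> X \<Longrightarrow> dist (\<phi> g x) (\<phi> g y) = dist x y"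
  using action by (simp add: isometric_action_def)

lemma act_conjugate:
  assumes "g \<in> carrier G" "s \<in> carrier G" "x \<in> X"
  shows "\<phi> (g \<otimes> s \<otimes> inv g) (\<phi> g x) = \<phi> g (\<phi> s x)"
proof -
  have "\<phi> (g \<otimes> s \<otimes> inv g) (\<phi> g x) = \<phi> (g \<otimes> s \<otimes> inv g \<otimes> g) x"
    using assms by (simp add: composition_rule)
  also have "g \<otimes> s \<otimes> inv g \<otimes> g = g \<otimes> s" using assms by (simp add: m_assoc)
  finally show ?thesis using assms by (simp add: composition_rule)
qed

definition fixed_points :: "'a set \<Rightarrow> 'x set" where
  "fixed_points T = {x \<in> X. \<forall>g\<in>T. \<phi> g x = x}"

lemma has_fixed_point_iff: "has_fixed_point \<phi> X T \<longleftrightarrow> fixed_points T \<noteq> {}"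
  by (auto simp: has_fixed_point_def fixed_points_def)

lemma fixed_points_Un: "fixed_points (S \<union> T) = fixed_points S \<inter> fixed_points T"
  by (auto simp: fixed_points_def)

lemma fixed_points_generate:
  assumes "T \<subseteq> carrier G"
  shows "fixed_points (generate G T) = fixed_points T"
proof
  show "fixed_points (generate G T) \<subseteq> fixed_points T"
    by (auto simp: fixed_points_def intro: generate.incl)
  show "fixed_points T \<subseteq> fixed_points (generate G T)"
  proof
    fix x assume x: "x \<in> fixed_points T"
    then have "subgroup (stabilizer G \<phi> x) G"
      by (simp add: fixed_points_def stabilizer_subgroup)
    moreover have "T \<subseteq> stabilizer G \<phi> x"
      using x assms by (auto simp: fixed_points_def stabilizer_def)
    ultimately have "generate G T \<subseteq> stabilizer G \<phi> x" by (rule generate_subgroup_incl[rotated])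
    then show "x \<in> fixed_points (generate G T)" using x by (auto simp: fixed_points_def stabilizer_def)
  qed
qed

lemma complete_fixed_points:
  assumes T: "T \<subseteq> carrier G"
  shows "complete (fixed_points T)"
  unfolding complete_def
proof (intro allI impI)
  fix s :: "nat \<Rightarrow> 'x" assume s: "(\<forall>n. s n \<in> fixed_points T) \<and> Cauchy s"
  then have sX: "s n \<in> X" for n by (simp add: fixed_points_def)
  then obtain l where l: "l \<in> X" "s \<longlonglongrightarrow> l"
    using complete_space s unfolding complete_def by blast
  have "\<phi> g l = l" if g: "g \<in> T" for g
  proof -
    have "dist (s n) (\<phi> g l) = dist (s n) l" for n
    proof -
      have "\<phi> g (s n) = s n" using s g by (simp add: fixed_points_def)
      then show ?thesis using dist_act[of g "s n" l] g T sX l(1) by auto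
    qed
    moreover have "(\<lambda>n. dist (s n) l) \<longlonglongrightarrow> 0" using l(2) tendsto_dist_iff by blast
    ultimately have "s \<longlonglongrightarrow> \<phi> g l" using tendsto_dist_iff[of s "\<phi> g l"] by simp
    then show ?thesis using l(2) LIMSEQ_unique by blast
  qed
  then show "\<exists>l\<in>fixed_points T. s \<longlonglongrightarrow> l" using l by (auto simp: fixed_points_def)
qed

text \<open>The image of a point between two fixed points has the same distances to both of them.\<close>

lemma convex_in_fixed_points:
  assumes T: "T \<subseteq> carrier G"
  shows "convex_in X (fixed_points T)"
  unfolding convex_in_def
proof (intro conjI ballI impI)
  show "fixed_points T \<subseteq> X" by (auto simp: fixed_points_def)
  fix x y z assume x: "x \<in> fixed_points T" and y: "y \<in> fixed_points T" and z: "z \<in> X"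
    and bet: "dist x z + dist z y = dist x y"
  have "\<phi> g z = z" if g: "g \<in> T" for g
  proof (rule between_unique[of x y])
    have gG: "g \<in> carrier G" using g T by blast
    show xX: "x \<in> X" and yX: "y \<in> X" using x y by (simp_all add: fixed_points_def)
    show "\<phi> g z \<in> X" using act_closed gG z by blast
    have gxy: "\<phi> g x = x" "\<phi> g y = y" using x y g by (simp_all add: fixed_points_def)
    show dx: "dist x (\<phi> g z) = dist x z" using dist_act[OF gG xX z] gxy by simp
    have "dist (\<phi> g z) y = dist z y" using dist_act[OF gG z yX] gxy by simp
    then show "dist x (\<phi> g z) + dist (\<phi> g z) y = dist x y" using dx bet by simp
  qed fact+
  then show "z \<in> fixed_points T" using z by (simp add: fixed_points_def)
qed

text \<open>The point of \<open>C\<close> nearest to a fixed point of \<open>T\<close> is unique, hence fixed by \<open>T\<close>.\<close>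

lemma fixed_point_in_invariant_convex:
  assumes C: "complete C" "convex_in X C" "C \<noteq> {}" and T: "T \<subseteq> carrier G"
    and inv: "\<And>g x. g \<in> T \<Longrightarrow> x \<in> C \<Longrightarrow> \<phi> g x \<in> C"
    and a: "fixed_points T \<noteq> {}"
  shows "C \<inter> fixed_points T \<noteq> {}"
proof -
  obtain a where a: "a \<in> X" "\<And>g. g \<in> T \<Longrightarrow> \<phi> g a = a" using a by (auto simp: fixed_points_def)
  obtain b where b: "b \<in> C" "\<And>x. x \<in> C \<Longrightarrow> (dist b a)\<^sup>2 + (dist x b)\<^sup>2 \<le> (dist x a)\<^sup>2"
    using nearest_point[OF C a(1)] by blast
  have bX: "b \<in> X" using b(1) C(2) by (auto simp: convex_in_def)
  have "\<phi> g b = b" if g: "g \<in> T" for g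
  proof -
    have "dist (\<phi> g b) a = dist b a" using dist_act[of g b a] a bX g T by auto
    then have "(dist (\<phi> g b) b)\<^sup>2 \<le> 0" using b(2)[OF inv[OF g b(1)]] by simp
    then show ?thesis by simp
  qed
  then show ?thesis using b(1) bX by (auto simp: fixed_points_def)
qed

text \<open>Conjugating back by \<open>g\<close> in \<open>T1\<close> turns elements of \<open>\<langle>T2\<rangle>\<close> into elements of \<open>\<langle>T2\<rangle>\<close>, so \<open>g\<close> preserves
  the fixed-point set of \<open>T2\<close>.\<close>

lemma fixed_points_normalised:
  assumes T: "T1 \<subseteq> carrier G" "T2 \<subseteq> carrier G"
    and norm: "generate G T1 \<subseteq> normalizer G (generate G T2)"
    and ne: "fixed_points T1 \<noteq> {}" "fixed_points T2 \<noteq> {}"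
  shows "fixed_points (T1 \<union> T2) \<noteq> {}"
proof -
  let ?H = "generate G T2"
  have H: "?H \<subseteq> carrier G" using T generate_incl by blast
  have "\<phi> g x \<in> fixed_points T2" if g: "g \<in> T1" and x: "x \<in> fixed_points T2" for g x
  proof -
    have gG: "g \<in> carrier G" using g T by blast
    have xX: "x \<in> X" using x by (simp add: fixed_points_def)
    have "g \<in> normalizer G ?H" using norm generate.incl[OF g, of G] by blast
    then have gH: "g <# ?H #> inv g = ?H" using H by (simp add: normalizer_def stabilizer_def)
    have "\<phi> t (\<phi> g x) = \<phi> g x" if "t \<in> T2" for t
    proof -
      have "t \<in> g <# ?H #> inv g" unfolding gH using that by (rule generate.incl)
      then obtain t' where t': "t' \<in> ?H" "t = g \<otimes> t' \<otimes> inv g"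
        by (auto simp: l_coset_def r_coset_def)
      then show ?thesis
        using act_conjugate[OF gG _ xX, of t'] H x unfolding fixed_points_generate[OF T(2), symmetric]
        by (auto simp: fixed_points_def)
    qed
    then show ?thesis using act_closed[OF gG xX] by (simp add: fixed_points_def)
  qed
  from fixed_point_in_invariant_convex[OF complete_fixed_points[OF T(2)] convex_in_fixed_points[OF T(2)]
      ne(2) T(1) this ne(1)]
  show ?thesis by (simp add: fixed_points_Un Int_commute)
qed

text \<open>Elements that commute with \<open>T i\<close> preserve its fixed-point set, so fixed points can be projected
  there one family at a time.\<close>

lemma fixed_points_commuting:
  assumes "finite I" and T: "\<And>i. i \<in> I \<Longrightarrow> T i \<subseteq> carrier G"
    and comm: "\<And>i j g h. i \<in> I \<Longrightarrow> j \<in> I \<Longrightarrow> i \<noteq> j \<Longrightarrow> g \<in> T i \<Longrightarrow> h \<in> T j \<Longrightarrow> g \<otimes> h = h \<otimes> g"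
    and ne: "\<And>i. i \<in> I \<Longrightarrow> fixed_points (T i) \<noteq> {}"
  shows "fixed_points (\<Union>i\<in>I. T i) \<noteq> {}"
  using assms
proof (induction I rule: finite_induct)
  case empty
  then show ?case using cat0 by (auto simp: fixed_points_def cat0_space_def)
next
  case (insert i I)
  let ?U = "\<Union>i\<in>I. T i"
  have TG: "T i \<subseteq> carrier G" "?U \<subseteq> carrier G" using insert.prems(1) by auto
  have "\<phi> g x \<in> fixed_points (T i)" if g: "g \<in> ?U" and x: "x \<in> fixed_points (T i)" for g x
  proof -
    have gG: "g \<in> carrier G" using g TG by blast
    have xX: "x \<in> X" using x by (simp add: fixed_points_def)
    have "\<phi> t (\<phi> g x) = \<phi> g x" if t: "t \<in> T i" for t
    proof -
      obtain j where j: "j \<in> I" "g \<in> T j" using g by blast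
      then have "j \<noteq> i" using insert.hyps by blast
      then have "t \<otimes> g = g \<otimes> t" using insert.prems(2)[of i j t g] j t by simp
      moreover have "t \<in> carrier G" using t TG by blast
      moreover have "\<phi> t x = x" using t x by (simp add: fixed_points_def)
      ultimately show ?thesis using composition_rule[OF xX] gG by metis
    qed
    then show ?thesis using act_closed[OF gG xX] by (simp add: fixed_points_def)
  qed
  moreover have "fixed_points ?U \<noteq> {}"
  proof (rule insert.IH)
    show "T j \<subseteq> carrier G" "fixed_points (T j) \<noteq> {}" if "j \<in> I" for j
      using insert.prems(1,3)[of j] that by simp_all
    show "g \<otimes> h = h \<otimes> g" if "j \<in> I" "k \<in> I" "j \<noteq> k" "g \<in> T j" "h \<in> T k" for j k g h
      using insert.prems(2)[of j k g h] that by simp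
  qed
  moreover have "fixed_points (T i) \<noteq> {}" using insert.prems(3) by simp
  ultimately have "fixed_points (T i) \<inter> fixed_points ?U \<noteq> {}"
    using fixed_point_in_invariant_convex[OF complete_fixed_points[OF TG(1)]
        convex_in_fixed_points[OF TG(1)] _ TG(2)] by blast
  then show ?case by (simp add: fixed_points_Un)
qed

text \<open>The fixed-point sets of the conjugated generators satisfy the hypothesis of \<open>block_helly\<close>: the
  conjugates of a proper subset of \<open>S\<close> have a common fixed point, and the blocks commute. A
  common point of one block is the translate of a fixed point of \<open>S\<close>.\<close>

lemma fixed_points_conjugates:
  assumes dim: "covering_dim_le (top_of_set X) d"
    and S: "S \<subseteq> carrier G" "finite S" and I: "finite I" "d < card I * (card S - 1)"
    and \<gamma>: "\<And>i. i \<in> I \<Longrightarrow> \<gamma> i \<in> carrier G"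
    and comm: "\<And>i j s t. i \<in> I \<Longrightarrow> j \<in> I \<Longrightarrow> i \<noteq> j \<Longrightarrow> s \<in> S \<Longrightarrow> t \<in> S \<Longrightarrow>
      (\<gamma> i \<otimes> s \<otimes> inv \<gamma> i) \<otimes> (\<gamma> j \<otimes> t \<otimes> inv \<gamma> j) = (\<gamma> j \<otimes> t \<otimes> inv \<gamma> j) \<otimes> (\<gamma> i \<otimes> s \<otimes> inv \<gamma> i)"
    and sub: "\<And>s. s \<in> S \<Longrightarrow> fixed_points (S - {s}) \<noteq> {}"
  shows "fixed_points S \<noteq> {}"
proof -
  define c where "c i s = \<gamma> i \<otimes> s \<otimes> inv \<gamma> i" for i s
  have cG: "c i s \<in> carrier G" if "i \<in> I" "s \<in> S" for i s
    using \<gamma>[OF that(1)] that(2) S by (auto simp: c_def)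
  have "\<exists>i\<in>I. \<exists>x\<in>X. \<forall>s\<in>S. x \<in> fixed_points {c i s}"
  proof (rule block_helly[OF dim I(1) S(2) I(2)])
    show "complete (fixed_points {c i s})" "convex_in X (fixed_points {c i s})"
      if "i \<in> I" "s \<in> S" for i s
      using cG[OF that] by (simp_all add: complete_fixed_points convex_in_fixed_points)
    fix e assume e: "e \<in> I \<rightarrow>\<^sub>E S"
    have "fixed_points (\<Union>i\<in>I. c i ` (S - {e i})) \<noteq> {}"
    proof (rule fixed_points_commuting[OF I(1)])
      fix i assume i: "i \<in> I"
      show "c i ` (S - {e i}) \<subseteq> carrier G" using cG i by auto
      have "e i \<in> S" using e i by auto
      then obtain x where x: "x \<in> fixed_points (S - {e i})" using sub by blast
      have "\<phi> (c i s) (\<phi> (\<gamma> i) x) = \<phi> (\<gamma> i) x" if "s \<in> S - {e i}" for s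
        using act_conjugate[OF \<gamma>[OF i], of s x] that x S by (auto simp: c_def fixed_points_def)
      then have "\<phi> (\<gamma> i) x \<in> fixed_points (c i ` (S - {e i}))"
        using act_closed[OF \<gamma>[OF i], of x] x by (simp add: fixed_points_def)
      then show "fixed_points (c i ` (S - {e i})) \<noteq> {}" by blast
    next
      fix i j g h assume "i \<in> I" "j \<in> I" "i \<noteq> j" "g \<in> c i ` (S - {e i})" "h \<in> c j ` (S - {e j})"
      then show "g \<otimes> h = h \<otimes> g" using comm unfolding c_def by blast
    qed
    then show "\<exists>x\<in>X. \<forall>i\<in>I. \<forall>s\<in>S - {e i}. x \<in> fixed_points {c i s}"
      by (auto simp: fixed_points_def)
  qed
  then obtain i x where i: "i \<in> I" and x: "x \<in> X" "\<And>s. s \<in> S \<Longrightarrow> \<phi> (c i s) x = x"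
    by (auto simp: fixed_points_def)
  define y where "y = \<phi> (inv \<gamma> i) x"
  have gG: "\<gamma> i \<in> carrier G" "inv \<gamma> i \<in> carrier G" using \<gamma>[OF i] by auto
  have yX: "y \<in> X" using act_closed[OF gG(2) x(1)] by (simp add: y_def)
  have gy: "\<phi> (\<gamma> i) y = x"
    using orbit_sym_aux[OF gG(2) x(1), of y] gG by (simp add: y_def)
  have "\<phi> s y = y" if s: "s \<in> S" for s
  proof -
    have sG: "s \<in> carrier G" using s S by blast
    have "\<phi> (\<gamma> i) (\<phi> s y) = \<phi> (\<gamma> i) y"
      using act_conjugate[OF gG(1) sG yX] x(2)[OF s] gy by (simp add: c_def)
    then show ?thesis using inj_prop[OF gG(1)] act_closed[OF sG yX] yX by (simp add: inj_on_eq_iff)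
  qed
  then show ?thesis using yX by (auto simp: fixed_points_def)
qed

text \<open>Minimality provides fixed points of all proper subsets of a counterexample \<open>S\<close>. Then
  \<open>fixed_points_normalised\<close> excludes the first alternative of ample duplication, and
  \<open>fixed_points_conjugates\<close> excludes the second, as well as all \<open>S\<close> with more than \<open>d + 1\<close>
  elements.\<close>

lemma fixed_points_ample_duplication:
  assumes dim: "covering_dim_le (top_of_set X) d"
    and A: "finite A" "A \<subseteq> carrier G" and ample: "ample_duplication G A d k0"
    and small: "\<And>S. S \<subseteq> A \<Longrightarrow> card S \<le> k0 \<Longrightarrow> fixed_points S \<noteq> {}"
    and "S \<subseteq> A"
  shows "fixed_points S \<noteq> {}"
proof -
  obtain f where f: "\<forall>S. S \<subseteq> A \<and> card S > k0 \<longrightarrow>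
        (\<exists>S1 S2. S = S1 \<union> S2 \<and> S1 \<inter> S2 = {} \<and> S1 \<noteq> {} \<and> S2 \<noteq> {} \<and>
                 generate G S1 \<subseteq> normalizer G (generate G S2)) \<or>
        (\<exists>C. C \<subseteq> conjugates G (generate G S) \<and> finite C \<and> card C \<ge> f (card S) \<and>
             pairwise (commuting_subgroups G) C)"
    and fk: "\<forall>k \<in> {k0 + 1..min (d + 1) (card A)}. d < (k - 1) * f k"
    using ample unfolding ample_duplication_def by (elim exE conjE)
  have "finite S" using A(1) \<open>S \<subseteq> A\<close> by (rule rev_finite_subset)
  then show ?thesis using \<open>S \<subseteq> A\<close>
  proof (induction S rule: finite_psubset_induct)
    case (psubset S)
    have SG: "S \<subseteq> carrier G" using psubset.prems A by blast
    have IH: "fixed_points B \<noteq> {}" if "B \<subset> S" for B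
      using psubset.IH[OF that] that psubset.prems by blast
    consider "card S \<le> k0" | "k0 < card S" "d + 1 < card S" | "k0 < card S" "card S \<le> d + 1" by linarith
    then show ?case
    proof cases
      case 1
      then show ?thesis using small psubset.prems by blast
    next
      case 2
      show ?thesis
        (* Here one block, the generators themselves, already has more than d + 1 sets. *)
        by (rule fixed_points_conjugates[OF dim SG psubset.hyps, of "{()}" "\<lambda>_. \<one>"])
          (use 2 IH in auto)
    next
      case 3
      from f[rule_format, OF conjI[OF psubset.prems 3(1)]] show ?thesis
      proof (elim disjE exE conjE)
        fix S1 S2 assume "S = S1 \<union> S2" "S1 \<inter> S2 = {}" "S1 \<noteq> {}" "S2 \<noteq> {}"
          "generate G S1 \<subseteq> normalizer G (generate G S2)"
        moreover from this have "S1 \<subset> S" "S2 \<subset> S" by auto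
        ultimately show ?thesis
          using fixed_points_normalised[of S1 S2] IH[of S1] IH[of S2] SG by auto
      next
        fix C assume C: "C \<subseteq> conjugates G (generate G S)" "finite C" "card C \<ge> f (card S)"
          "pairwise (commuting_subgroups G) C"
        have "d < (card S - 1) * f (card S)"
          using 3 card_mono[OF A(1) psubset.prems] by (intro fk[rule_format]) auto
        also have "\<dots> \<le> card C * (card S - 1)" using C(3) by simp
        finally have d: "d < card C * (card S - 1)" .
        have "\<forall>c\<in>C. \<exists>g. g \<in> carrier G \<and> c = g <# generate G S #> inv g"
          using C(1) by (auto simp: conjugates_def)
        then obtain \<gamma> where \<gamma>: "\<And>c. c \<in> C \<Longrightarrow> \<gamma> c \<in> carrier G"
          "\<And>c. c \<in> C \<Longrightarrow> c = \<gamma> c <# generate G S #> inv \<gamma> c" by metis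
        have mem: "\<gamma> c \<otimes> s \<otimes> inv \<gamma> c \<in> c" if "c \<in> C" "s \<in> S" for c s
        proof -
          have "\<gamma> c \<otimes> s \<otimes> inv \<gamma> c \<in> \<gamma> c <# generate G S #> inv \<gamma> c"
            using generate.incl[OF that(2)] by (auto simp: l_coset_def r_coset_def)
          then show ?thesis using \<gamma>(2)[OF that(1)] by simp
        qed
        show ?thesis
        proof (rule fixed_points_conjugates[OF dim SG psubset.hyps C(2) d \<gamma>(1)])
          fix c c' s t assume c: "c \<in> C" "c' \<in> C" "c \<noteq> c'" "s \<in> S" "t \<in> S"
          then have "commuting_subgroups G c c'" using C(4) by (simp add: pairwise_def)
          then show "(\<gamma> c \<otimes> s \<otimes> inv \<gamma> c) \<otimes> (\<gamma> c' \<otimes> t \<otimes> inv \<gamma> c') = (\<gamma> c' \<otimes> t \<otimes> inv \<gamma> c') \<otimes> (\<gamma> c \<otimes> s \<otimes> inv \<gamma> c)"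
            using mem c \<gamma>(1) SG by (intro commuting_subgroupsD) auto
        qed (use IH in auto)
      qed
    qed
  qed
qed

end

theorem theorem3:
  fixes G :: "('g, 'b) monoid_scheme"
    and X :: "'x::metric_space set"
    and \<phi> :: "'g \<Rightarrow> 'x \<Rightarrow> 'x"
    and L A :: "'g set"
    and d k0 :: nat
  assumes "d > 0" and "k0 > 0"
    and "group G"
    and "complete X" and "cat0_space X"
    and "covering_dim_le (top_of_set X) d"
    and "isometric_action G X \<phi>"
    and "subgroup L G"
    and "finite A" and "A \<subseteq> carrier G" and "generate G A = L"
    and "ample_duplication G A d k0"
    and "\<And>S. S \<subseteq> A \<Longrightarrow> card S \<le> k0 \<Longrightarrow> has_fixed_point \<phi> X (generate G S)"
  shows "has_fixed_point \<phi> X L"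
proof -
  interpret group G by fact
  interpret hadamard_action G X \<phi>
    by unfold_locales fact+
  have fixed_iff: "has_fixed_point \<phi> X (generate G S) \<longleftrightarrow> fixed_points S \<noteq> {}" if "S \<subseteq> A" for S
    using that assms(10) by (simp add: has_fixed_point_iff fixed_points_generate)
  have "fixed_points A \<noteq> {}"
    using fixed_points_ample_duplication[OF assms(6,9,10,12)] assms(13) fixed_iff by blast
  then show ?thesis using fixed_iff[of A] assms(11) by simp
qed

end
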